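(* Let $n>1$, and let $\mathcal{R}=(V,E,E^{*})$ be an R-colouring R-graph, where $V_1,\dots,V_n$ are the (distinct) connected components of the graph $(V,E^{*})$. Suppose that $|V_i|\geq 2\mathbf{m}(V_i)+1$ for each $i\in\{1,\dots,n\}$. If $|I(V)|\leq n$, then $\mathcal{R}$ has an R-cycle.
   Context: All graphs are finite, simple and undirected. A path $v_0v_1\cdots v_p$ has pairwise distinct vertices; its origin is $v_0$ and its terminus is $v_p$. Components are connected components, regarded as vertex sets (an isolated vertex forms a component). R-graph: let $\mathcal{G}=(V,E)$ and $\mathcal{G}^{*}=(V,E^{*})$ be simple graphs with the same vertex set. For $v\in V$ put $U(v)=\{w\in V\mid vw\in E^{*}\}\cup\{v\}$. The triple $(V,E,E^{*})$ is an R-graph if $|U(v)\cap C|\leq 1$ for every $v\in V$ and every component $C$ of $\mathcal{G}$. R-cycle: let $p>1$ and let $\pi_q$ ($1\le q\le p$) be a path in $\mathcal{G}$ with origin $v_q$ and terminus $w_q$. The sequence $(\pi_1,\dots,\pi_p)$ is an R-cycle (of length $p$) in $(V,E,E^{*})$ if all of the $v_q$'s and $w_q$'s are different from each other, $w_qv_{q+1}\in E^{*}$ for $1\leq q\leq p-1$, and $w_pv_1\in E^{*}$. R-colouring: let $V_1,\dots,V_n$ be the components of $\mathcal{G}^{*}$, and put $U^{o}(v)=U(v)\setminus\{v\}$. On each $V_i$ define the equivalence relation $v\simeq v'$ iff $U^{o}(v)=U^{o}(v')$, and let $V_{i1},\dots,V_{il_i}$ be its equivalence classes. The R-graph is an R-colouring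 R-graph if for every $i$, every $j$ and every $v\in V_{ij}$ one has $U^{o}(v)=V_i\setminus V_{ij}$ (equivalently, the subgraph of $\mathcal{G}^{*}$ induced on $V_i$ is complete multipartite with parts $V_{i1},\dots,V_{il_i}$). Put $\mathbf{m}(V_i)=\max\{|V_{ij}| \mid 1\le j\le l_i\}$. $I(V)=\{v\in V\mid v \text{ has degree } 0 \text{ in } \mathcal{G}=(V,E)\}$. *)

theory Defs
  imports "Graph_Theory.Digraph_Component_Vwalk"
begin

text \<open>
  A simple graph is a \<open>pair_graph\<close>: finite, loop-free, and with a symmetric set of arcs, so that
  the undirected edge \<open>vw\<close> is the pair of arcs \<open>(v, w)\<close> and \<open>(w, v)\<close>. A triple \<open>(V, E, E\<^sup>*)\<close> is
  represented by the two graphs \<open>G = (V, E)\<close> and \<open>H = (V, E\<^sup>*)\<close>. Since reachability in a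
  \<open>pair_graph\<close> is symmetric, its strongly connected components \<open>sccs_verts\<close> are its connected
  components as vertex sets.
\<close>

abbreviation components :: "'a pair_pre_digraph \<Rightarrow> 'a set set" where
  "components G \<equiv> pre_digraph.sccs_verts (with_proj G)"

definition nbhd :: "'a pair_pre_digraph \<Rightarrow> 'a \<Rightarrow> 'a set" where
  "nbhd H v = {w \<in> pverts H. (v, w) \<in> parcs H} \<union> {v}"

definition open_nbhd :: "'a pair_pre_digraph \<Rightarrow> 'a \<Rightarrow> 'a set" where
  "open_nbhd H v = nbhd H v - {v}"

definition R_graph :: "'a pair_pre_digraph \<Rightarrow> 'a pair_pre_digraph \<Rightarrow> bool" where
  "R_graph G H \<longleftrightarrow>
     pair_graph G \<and> pair_graph H \<and> pverts G = pverts H \<and>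
     (\<forall>v \<in> pverts G. \<forall>C \<in> components G. card (nbhd H v \<inter> C) \<le> 1)"

text \<open>
  The origin and terminus of a path are the \<open>hd\<close> and \<open>last\<close> of its vertex list. The \<open>2p\<close> origins
  and termini are pairwise distinct; in particular every path has at least one edge. No other
  disjointness of the paths is required.
\<close>

definition R_cycle ::
  "'a pair_pre_digraph \<Rightarrow> 'a pair_pre_digraph \<Rightarrow> 'a list list \<Rightarrow> bool" where
  "R_cycle G H ps \<longleftrightarrow>
     length ps > 1 \<and>
     (\<forall>p \<in> set ps. vpath p (with_proj G)) \<and>
     distinct (map hd ps @ map last ps) \<and>
     (\<forall>q. Suc q < length ps \<longrightarrow> (last (ps ! q), hd (ps ! Suc q)) \<in> parcs H) \<and>
     (last (last ps), hd (hd ps)) \<in> parcs H"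

definition same_open_nbhd :: "'a pair_pre_digraph \<Rightarrow> 'a set \<Rightarrow> 'a rel" where
  "same_open_nbhd H C = {(v, w). v \<in> C \<and> w \<in> C \<and> open_nbhd H v = open_nbhd H w}"

definition parts :: "'a pair_pre_digraph \<Rightarrow> 'a set \<Rightarrow> 'a set set" where
  "parts H C = C // same_open_nbhd H C"

definition R_colouring :: "'a pair_pre_digraph \<Rightarrow> 'a pair_pre_digraph \<Rightarrow> bool" where
  "R_colouring G H \<longleftrightarrow>
     R_graph G H \<and>
     (\<forall>C \<in> components H. \<forall>P \<in> parts H C. \<forall>v \<in> P. open_nbhd H v = C - P)"

definition max_part :: "'a pair_pre_digraph \<Rightarrow> 'a set \<Rightarrow> nat" where
  "max_part H C = Max (card ` parts H C)"

text \<open>The degree of a vertex in a simple graph is its out-degree in the symmetric digraph.\<close>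

definition isolated :: "'a pair_pre_digraph \<Rightarrow> 'a set" where
  "isolated G = {v \<in> pverts G. out_degree (with_proj G) v = 0}"

end

theory Submission
  imports Defs
begin

text \<open>
  Call a set of vertices of \<open>V\<^sub>i\<close> rainbow if it meets every part of \<open>V\<^sub>i\<close> at most once. Mapping every
  part injectively into \<open>m(V\<^sub>i)\<close> labels splits \<open>V\<^sub>i\<close> into at most \<open>m(V\<^sub>i)\<close> rainbow blocks, in which any
  two vertices are joined by an edge of \<open>E\<^sup>*\<close>. Regard every vertex of \<open>V\<close> as an edge of the bipartite
  multigraph \<open>B\<close> whose nodes are the components of \<open>(V, E)\<close> and the blocks. If there are \<open>c\<close>
  components and \<open>M\<close> blocks, then \<open>|V| \<ge> 2M + n\<close> because \<open>|V\<^sub>i| \<ge> 2m(V\<^sub>i) + 1\<close>, and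
  \<open>|V| \<ge> 2c - |I(V)| \<ge> 2c - n\<close>. Hence \<open>|V| \<ge> M + c\<close>, so \<open>B\<close> has at least as many edges as nodes and
  contains a cycle. The edges of this cycle are the successive origins and termini of an
  R-cycle; its length exceeds 1 because no edge of \<open>E\<^sup>*\<close> has both ends in one component of \<open>(V, E)\<close>.
\<close>

section \<open>Cycles in a bipartite multigraph whose edges are incident via two maps\<close>

text \<open>Deleting an element that is alone in its \<open>g\<close>-fibre or
  \<open>b\<close>-fibre lowers \<open>card S\<close> by one and the sum of the image sizes by at
  least one, so the inequality survives. In \<open>B\<close> this prunes the edges at nodes of
  degree 1.\<close>

lemma ex_nontrivial_fibres:
  fixes g :: "'a \<Rightarrow> 'b" and b :: "'a \<Rightarrow> 'c"
  assumes "finite S" "S \<noteq> {}" "card (g ` S) + card (b ` S) \<le> card S"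
  shows "\<exists>T \<subseteq> S. T \<noteq> {} \<and> (\<forall>v \<in> T. (\<exists>w \<in> T. w \<noteq> v \<and> g w = g v) \<and> (\<exists>w \<in> T. w \<noteq> v \<and> b w = b v))"
  using assms
proof (induction S rule: finite_psubset_induct)
  case (psubset S)
  show ?case
  proof (cases "\<forall>v \<in> S. (\<exists>w \<in> S. w \<noteq> v \<and> g w = g v) \<and> (\<exists>w \<in> S. w \<noteq> v \<and> b w = b v)")
    case True
    then show ?thesis using psubset.prems by blast
  next
    case False
    then obtain v where v: "v \<in> S" "g v \<notin> g ` (S - {v}) \<or> b v \<notin> b ` (S - {v})"
      by force
    let ?S = "S - {v}"
    have fin: "finite ?S" using psubset.hyps by simp
    have gS: "g ` S = insert (g v) (g ` ?S)" and bS: "b ` S = insert (b v) (b ` ?S)"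
      using v by auto
    have card_S: "card S = Suc (card ?S)"
      using v psubset.hyps by (metis card_Suc_Diff1)
    \<comment> \<open>Both images are nonempty, so \<open>card S\<close> is at least 2 and the
      deletion leaves a nonempty set.\<close>
    have "card (g ` S) > 0" "card (b ` S) > 0"
      using psubset by (auto simp: card_gt_0_iff)
    then have "card ?S \<noteq> 0" using psubset.prems(2) card_S by linarith
    then have ne: "?S \<noteq> {}" by (metis card.empty)
    have "card (g ` ?S) + card (b ` ?S) < card (g ` S) + card (b ` S)"
    proof -
      have "card (g ` ?S) \<le> card (g ` S)" "card (b ` ?S) \<le> card (b ` S)"
        using fin unfolding gS bS by (simp_all add: card_insert_if)
      moreover have "card (g ` ?S) < card (g ` S) \<or> card (b ` ?S) < card (b ` S)"
        using v(2) fin unfolding gS bS by (auto simp: card_insert_if simp del: image_insert)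
      ultimately show ?thesis by linarith
    qed
    then have "card (g ` ?S) + card (b ` ?S) \<le> card ?S"
      using psubset.prems card_S by linarith
    moreover have "?S \<subset> S" using v(1) by auto
    ultimately obtain T where "T \<subseteq> ?S" and T: "T \<noteq> {}"
      "\<forall>v \<in> T. (\<exists>w \<in> T. w \<noteq> v \<and> g w = g v) \<and> (\<exists>w \<in> T. w \<noteq> v \<and> b w = b v)"
      using psubset.IH[of ?S] ne by metis
    then have "T \<subseteq> S" by blast
    with T show ?thesis by (intro exI[of _ T] conjI)
  qed
qed

text \<open>The nodes of \<open>B\<close> met by a walk, rather than its edges, are watched for a repetition: two equal
  nodes lie on the same side of \<open>B\<close>, so the closed walk between them has even length.\<close>

lemma ex_alternating_cycle:
  fixes g :: "'a \<Rightarrow> 'b" and b :: "'a \<Rightarrow> 'c"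
  assumes fin: "finite S" and "S \<noteq> {}" and "card (g ` S) + card (b ` S) \<le> card S"
  obtains y :: "nat \<Rightarrow> 'a" and p where
    "p > 0" "inj_on y {..<2 * p}" "y ` {..<2 * p} \<subseteq> S"
    "\<And>q. q < p \<Longrightarrow> g (y (2 * q)) = g (y (2 * q + 1))"
    "\<And>q. Suc q < p \<Longrightarrow> b (y (2 * q + 1)) = b (y (2 * Suc q))"
    "b (y (2 * p - 1)) = b (y 0)"
proof -
  obtain T where T: "T \<subseteq> S" "T \<noteq> {}"
    and "\<forall>v \<in> T. (\<exists>w \<in> T. w \<noteq> v \<and> g w = g v) \<and> (\<exists>w \<in> T. w \<noteq> v \<and> b w = b v)"
    using ex_nontrivial_fibres[OF assms] by blast
  then obtain \<alpha> \<beta> where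
    \<alpha>: "\<And>v. v \<in> T \<Longrightarrow> \<alpha> v \<in> T \<and> \<alpha> v \<noteq> v \<and> g (\<alpha> v) = g v" and
    \<beta>: "\<And>v. v \<in> T \<Longrightarrow> \<beta> v \<in> T \<and> \<beta> v \<noteq> v \<and> b (\<beta> v) = b v"
    by metis
  obtain t where t: "t \<in> T" using T by blast
  \<comment> \<open>A walk in \<open>B\<close>, listed by its edges: successive ones share
    alternately a node of the \<open>g\<close> side and one of the \<open>b\<close> side.\<close>
  define x where "x = rec_nat t (\<lambda>k v. if even k then \<alpha> v else \<beta> v)"
  have x_Suc: "x (Suc k) = (if even k then \<alpha> (x k) else \<beta> (x k))" for k
    by (simp add: x_def)
  have xT: "x k \<in> T" for k
    by (induction k) (use t \<alpha> \<beta> in \<open>auto simp: x_Suc, simp add: x_def\<close>)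
  have x_neq: "x (Suc k) \<noteq> x k" for k
    using xT[of k] \<alpha> \<beta> by (simp add: x_Suc)
  have gx: "g (x (Suc k)) = g (x k)" if "even k" for k
    using xT[of k] \<alpha> that by (simp add: x_Suc)
  have bx: "b (x (Suc k)) = b (x k)" if "odd k" for k
    using xT[of k] \<beta> that by (simp add: x_Suc)
  \<comment> \<open>The node through which the walk passes from \<open>x k\<close> to
    \<open>x (Suc k)\<close>; the sum type keeps the two sides of \<open>B\<close> apart.\<close>
  define N where "N k = (if even k then Inl (g (x k)) else Inr (b (x k)))" for k
  have "\<not> inj N"
  proof
    assume "inj N"
    moreover have "range N \<subseteq> Inl ` g ` S \<union> Inr ` b ` S"
    proof (rule image_subsetI)
      show "N k \<in> Inl ` g ` S \<union> Inr ` b ` S" for k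
        using xT[of k] T by (cases "even k") (auto simp: N_def)
    qed
    then have "finite (range N)" using fin by (meson finite_UnI finite_imageI finite_subset)
    ultimately show False using finite_imageD by blast
  qed
  then have "\<exists>j. \<exists>i<j. N i = N j"
    unfolding inj_def by (metis nat_neq_iff)
  \<comment> \<open>By minimality the nodes before \<open>N j\<close> are pairwise distinct.\<close>
  define j where "j = (LEAST j. \<exists>i<j. N i = N j)"
  have "\<exists>i<j. N i = N j"
    unfolding j_def by (rule LeastI_ex) fact
  then obtain i where i: "i < j" "N i = N j" by blast
  have least: "\<not> (k < l \<and> l < j \<and> N k = N l)" for k l
    using not_less_Least[of l "\<lambda>j. \<exists>i<j. N i = N j"] unfolding j_def by blast
  have par: "even i \<longleftrightarrow> even j"
    using i(2) by (auto simp: N_def split: if_splits)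
  have close: "(if even i then g (x i) = g (x j) else b (x i) = b (x j))"
    using i(2) par by (auto simp: N_def split: if_splits)
  \<comment> \<open>For equal parities, \<open>x k = x l\<close> would repeat a node too early. For
    different parities it gives \<open>N (l - 1) = N k\<close>, hence \<open>k = l - 1\<close>, and
    two successive edges would coincide.\<close>
  have x_inj: "x k \<noteq> x l" if kl: "i < k" "k < l" "l \<le> j" for k l
  proof
    assume eq: "x k = x l"
    obtain k' l' where k': "k = Suc k'" and l': "l = Suc l'"
      using kl by (cases k; cases l) auto
    show False
    proof (cases "even k \<longleftrightarrow> even l")
      case True
      then have "N k = N l" using eq by (simp add: N_def)
      then show False
        using least[of k l] least[of i k] i kl by (cases "l = j") auto
    next
      case False
      then have "N l' = N k"
        using eq gx[of l'] bx[of l'] by (auto simp: N_def l')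
      then have "k = l'"
        using least[of k l'] kl l' by auto
      then show False using eq x_neq l' by metis
    qed
  qed
  obtain p where p: "j = i + 2 * p"
    using par i(1) by (metis dvdE even_diff_nat le_add_diff_inverse less_imp_le even_add)
  have p0: "p > 0" using i(1) p by simp
  show ?thesis
  proof (cases "even i")
    case False
    \<comment> \<open>The repeated node is on the \<open>b\<close> side, so the edges from
      \<open>x (Suc i)\<close> on begin with a pair sharing its \<open>g\<close> value.\<close>
    show ?thesis
    proof (rule that[of p "\<lambda>k. x (Suc (i + k))"])
      show "inj_on (\<lambda>k. x (Suc (i + k))) {..<2 * p}"
        by (rule linorder_inj_onI) (use x_inj p in auto)
      show "b (x (Suc (i + (2 * p - 1)))) = b (x (Suc (i + 0)))"
        using close False bx[of i] p p0 by simp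
    qed (use p0 xT T False gx bx in \<open>auto simp: image_subset_iff\<close>)
  next
    case True
    \<comment> \<open>The repeated node is on the \<open>g\<close> side; moving \<open>x j\<close>
      to the front pairs it with \<open>x (Suc i)\<close>.\<close>
    define y where "y k = (if k = 0 then x j else x (i + k))" for k
    show ?thesis
    proof (rule that[of p y])
      have "y k \<noteq> y l" if "k < l" "l < 2 * p" for k l
        using x_inj[of "i + l" j] x_inj[of "i + k" "i + l"] that p by (auto simp: y_def)
      then show "inj_on y {..<2 * p}"
        by (auto intro!: linorder_inj_onI)
      show "g (y (2 * q)) = g (y (2 * q + 1))" if "q < p" for q
        using gx[of "i + 2 * q"] gx[of i] close True by (auto simp: y_def)
      show "b (y (2 * q + 1)) = b (y (2 * Suc q))" if "Suc q < p" for q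
        using bx[of "Suc (i + 2 * q)"] True by (auto simp: y_def)
      show "b (y (2 * p - 1)) = b (y 0)"
        using bx[of "i + 2 * p - 1"] True p0 p by (auto simp: y_def)
    qed (use p0 xT T in \<open>auto simp: y_def image_subset_iff\<close>)
  qed
qed

section \<open>Counting components and splitting into rainbow blocks\<close>

text \<open>A one-vertex component consists of an isolated vertex, so every component counts at
  least 2 once its isolated vertices are counted twice.\<close>

lemma twice_card_components_le:
  assumes "pair_graph G"
  shows "2 * card (components G) \<le> card (pverts G) + card (isolated G)"
proof -
  interpret pair_graph G by fact
  have fin: "finite (components G)" by (rule finite_sccs_verts)
  have sub: "C \<subseteq> pverts G" if "C \<in> components G" for C
    using sccs_verts_subsets[OF that] by simp
  have finC: "finite C" if "C \<in> components G" for C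
    using sub[OF that] pair_finite_verts by (rule finite_subset)
  have disj: "\<forall>C \<in> components G. \<forall>D \<in> components G. C \<noteq> D \<longrightarrow> C \<inter> D = {}"
    using sccs_verts_disjoint by blast
  have card_eq: "card (pverts G \<inter> A) = (\<Sum>C \<in> components G. card (C \<inter> A))" for A
  proof -
    have "pverts G \<inter> A = (\<Union>C \<in> components G. C \<inter> A)"
      using sub scc_of_in_sccs_verts in_scc_of_self by fastforce
    also have "card \<dots> = (\<Sum>C \<in> components G. card (C \<inter> A))"
      using fin finC disj by (intro card_UN_disjoint ballI impI finite_Int disjI1) blast+
    finally show ?thesis .
  qed
  have "2 \<le> card C + card (C \<inter> isolated G)" if C: "C \<in> components G" for C
  proof -
    obtain v where v: "v \<in> C" using C by (auto simp: in_sccs_verts_conv_reachable)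
    show ?thesis
    proof (cases "v \<in> isolated G")
      case True
      then have "card C \<noteq> 0" "card (C \<inter> isolated G) \<noteq> 0"
        using v finC[OF C] by auto
      then show ?thesis by linarith
    next
      case False
      then obtain w where w: "(v, w) \<in> parcs G"
        using v sub[OF C] finite_out_arcs[of v] by (auto simp: isolated_def out_degree_def)
      then have "v \<rightarrow>\<^sup>*\<^bsub>with_proj G\<^esub> w" "w \<rightarrow>\<^sup>*\<^bsub>with_proj G\<^esub> v"
        using symmetric_reachable' by (auto simp: reachable_adjI with_proj_simps)
      then have "w \<in> C" using C v by (auto simp: in_sccs_verts_conv_reachable)
      moreover have "w \<noteq> v" using w no_loops' by blast
      ultimately have "card {v, w} = 2" "{v, w} \<subseteq> C" using v by auto
      then have "2 \<le> card C" using card_mono[OF finC[OF C], of "{v, w}"] by simp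
      then show ?thesis by simp
    qed
  qed
  then have "(\<Sum>C \<in> components G. 2) \<le> (\<Sum>C \<in> components G. card C + card (C \<inter> isolated G))"
    by (intro sum_mono)
  also have "\<dots> = card (pverts G) + card (pverts G \<inter> isolated G)"
    using card_eq[of UNIV] card_eq[of "isolated G"] by (simp add: sum.distrib)
  also have "pverts G \<inter> isolated G = isolated G" by (auto simp: isolated_def)
  finally show ?thesis by simp
qed

text \<open>Each part embeds into the labels by its size. The parts partition \<open>C\<close>, so
  these embeddings glue to one map, whose fibres are the rainbow blocks.\<close>

lemma ex_inj_on_parts:
  assumes "finite C"
  shows "\<exists>f. f ` C \<subseteq> {..<max_part H C} \<and> (\<forall>P \<in> parts H C. inj_on f P)"
proof -
  have equiv: "equiv C (same_open_nbhd H C)"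
    by (auto simp: same_open_nbhd_def equiv_def refl_on_def sym_def trans_def)
  let ?part = "\<lambda>v. same_open_nbhd H C `` {v}"
  have "\<exists>h. inj_on h P \<and> h ` P \<subseteq> {..<max_part H C}" if P: "P \<in> parts H C" for P
  proof -
    have "finite (parts H C)"
      using assms equiv unfolding parts_def equiv_def by (intro finite_quotient) auto
    then have "card P \<le> card {..<max_part H C}"
      using P by (simp add: max_part_def)
    moreover have "finite P"
      using P assms finite_subset by (fastforce simp: parts_def quotient_def same_open_nbhd_def)
    ultimately show ?thesis
      using card_le_inj[of P "{..<max_part H C}"] by auto
  qed
  then obtain h where h: "inj_on (h P) P" "h P ` P \<subseteq> {..<max_part H C}" if "P \<in> parts H C" for P
    by metis
  define f where "f v = h (?part v) v" for v
  have part: "?part v \<in> parts H C" "v \<in> ?part v" if "v \<in> C" for v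
    using that quotientI[of v C "same_open_nbhd H C"] by (auto simp: parts_def same_open_nbhd_def)
  have part_eq: "?part v = P" "v \<in> C" if "P \<in> parts H C" "v \<in> P" for v P
    using that equiv unfolding parts_def by (auto simp: same_open_nbhd_def quotient_def)
  have "f ` C \<subseteq> {..<max_part H C}"
    using h(2) part by (fastforce simp: f_def)
  moreover have "inj_on f P" if P: "P \<in> parts H C" for P
    using h(1)[OF P] part_eq(1)[OF P] by (simp add: f_def inj_on_def)
  ultimately show ?thesis by blast
qed

section \<open>Construction of the R-cycle\<close>

theorem theorem3p11:
  fixes G H :: "'a pair_pre_digraph" and n :: nat and W :: "nat \<Rightarrow> 'a set"
  assumes "n > 1"
    and "R_colouring G H"
    and "bij_betw W {1..n} (components H)"
    and "\<forall>i \<in> {1..n}. card (W i) \<ge> 2 * max_part H (W i) + 1"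
    and "card (isolated G) \<le> n"
  shows "\<exists>ps. R_cycle G H ps"
proof -
  have RG: "R_graph G H" using assms(2) by (simp add: R_colouring_def)
  interpret G: pair_graph G using RG by (simp add: R_graph_def)
  interpret H: pair_graph H using RG by (simp add: R_graph_def)
  have V: "pverts G = pverts H" using RG by (simp add: R_graph_def)
  define g where "g = pre_digraph.scc_of (with_proj G)"
  define c where "c = pre_digraph.scc_of (with_proj H)"
  have g_img: "g ` pverts G = components G"
    using G.sccs_verts_conv_scc_of by (simp add: g_def)
  have c_img: "c ` pverts G = components H"
    using H.sccs_verts_conv_scc_of V by (simp add: c_def)
  have in_g: "v \<in> g v" and in_c: "v \<in> c v" if "v \<in> pverts G" for v
    using that G.in_scc_of_self H.in_scc_of_self V by (auto simp: g_def c_def)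
  have finC: "finite C" if "C \<in> components H" for C
    using H.sccs_verts_subsets[OF that] H.pair_finite_verts by (auto intro: finite_subset)
  have disjC: "\<forall>C \<in> components H. \<forall>D \<in> components H. C \<noteq> D \<longrightarrow> C \<inter> D = {}"
    using H.sccs_verts_disjoint by blast
  have finH: "finite (components H)" by (rule H.finite_sccs_verts)
  have "\<forall>C \<in> components H. \<exists>f. f ` C \<subseteq> {..<max_part H C} \<and> (\<forall>P \<in> parts H C. inj_on f P)"
    using ex_inj_on_parts finC by blast
  then obtain f where f: "\<And>C. C \<in> components H \<Longrightarrow> f C ` C \<subseteq> {..<max_part H C}"
      "\<And>C P. C \<in> components H \<Longrightarrow> P \<in> parts H C \<Longrightarrow> inj_on (f C) P"
    by metis
  \<comment> \<open>The block of \<open>v\<close>; pairing with \<open>c v\<close> keeps equal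
    labels in different components of \<open>H\<close> apart.\<close>
  define b where "b v = (c v, f (c v) v)" for v

  \<comment> \<open>Distinct vertices with the same label lie in different parts, because
    \<open>f\<close> is injective on each part.\<close>
  have joined: "(v, w) \<in> parcs H" if "v \<in> pverts G" "w \<in> pverts G" "v \<noteq> w" "b v = b w" for v w
  proof -
    have C: "c v \<in> components H" using c_img that by blast
    have w: "w \<in> c v" "v \<in> c v" using that in_c by (auto simp: b_def)
    define P where "P = same_open_nbhd H (c v) `` {v}"
    have P: "P \<in> parts H (c v)" "v \<in> P"
      using w by (auto simp: P_def parts_def quotient_def same_open_nbhd_def)
    have "w \<notin> P"
      using f(2)[OF C P(1)] P(2) that by (auto simp: b_def inj_on_def)
    moreover have "open_nbhd H v = c v - P"
      using assms(2) C P by (simp add: R_colouring_def)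
    ultimately show ?thesis
      using w that by (auto simp: open_nbhd_def nbhd_def)
  qed

  have "card (g ` pverts G) + card (b ` pverts G) \<le> card (pverts G)"
  proof -
    have "b ` pverts G \<subseteq> (SIGMA C:components H. {..<max_part H C})"
      using f(1) c_img in_c by (fastforce simp: b_def)
    then have "card (b ` pverts G) \<le> card (SIGMA C:components H. {..<max_part H C})"
      using finH by (intro card_mono) auto
    also have "\<dots> = (\<Sum>C \<in> components H. max_part H C)"
      using finH by (simp add: card_SigmaI)
    finally have b: "card (b ` pverts G) \<le> (\<Sum>C \<in> components H. max_part H C)" .
    have "card (components H) = n"
      using bij_betw_same_card[OF assms(3)] by simp
    moreover have "(\<Sum>C \<in> components H. 2 * max_part H C + 1) \<le> (\<Sum>C \<in> components H. card C)"
    proof (rule sum_mono)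
      fix C assume "C \<in> components H"
      then have "C \<in> W ` {1..n}"
        unfolding bij_betw_imp_surj_on[OF assms(3)] .
      then show "2 * max_part H C + 1 \<le> card C"
        using assms(4) by (elim imageE) simp
    qed
    moreover have "(\<Sum>C \<in> components H. card C) = card (\<Union> (components H))"
      using finC disjC by (intro card_Union_disjoint[symmetric]) (auto simp: pairwise_def disjnt_def)
    moreover have "\<Union> (components H) = pverts G"
    proof
      show "\<Union> (components H) \<subseteq> pverts G"
        unfolding V by (rule Union_least) (use H.sccs_verts_subsets in simp)
      show "pverts G \<subseteq> \<Union> (components H)"
        unfolding c_img[symmetric] using in_c by blast
    qed
    \<comment> \<open>The \<open>n\<close> gained here from the \<open>+ 1\<close> in each component
      of \<open>H\<close> cancels the \<open>n\<close> allowed for isolated vertices in the next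
      bound.\<close>
    ultimately have "2 * (\<Sum>C \<in> components H. max_part H C) + n \<le> card (pverts G)"
      by (simp only: sum.distrib sum_distrib_left card_eq_sum)
    moreover have "2 * card (g ` pverts G) \<le> card (pverts G) + n"
      using twice_card_components_le[OF G.pair_graph] assms(5) by (simp add: g_img)
    ultimately show ?thesis using b by linarith
  qed
  moreover have "finite (pverts G)" by (rule G.pair_finite_verts)
  moreover have "pverts G \<noteq> {}"
  proof
    assume "pverts G = {}"
    then have "card (components H) = 0" using c_img by auto
    then show False using bij_betw_same_card[OF assms(3)] assms(1) by simp
  qed
  ultimately obtain y p where y: "p > 0" "inj_on y {..<2 * p}" "y ` {..<2 * p} \<subseteq> pverts G"
    and gy: "\<And>q. q < p \<Longrightarrow> g (y (2 * q)) = g (y (2 * q + 1))"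
    and b_y: "\<And>q. Suc q < p \<Longrightarrow> b (y (2 * q + 1)) = b (y (2 * Suc q))" "b (y (2 * p - 1)) = b (y 0)"
    using ex_alternating_cycle[of "pverts G" g b] by metis
  have yV: "y k \<in> pverts G" if "k < 2 * p" for k using y(3) that by auto
  have y_eq: "y k = y l \<longleftrightarrow> k = l" if "k < 2 * p" "l < 2 * p" for k l
    using y(2) that by (auto simp: inj_on_def)

  \<comment> \<open>For \<open>p = 1\<close> the two edges of \<open>B\<close> share both nodes:
    \<open>y 0\<close> and \<open>y 1\<close> are adjacent in \<open>H\<close> and lie in one
    component of \<open>G\<close>, against \<open>R_graph\<close>.\<close>
  have "p \<noteq> 1"
  proof
    assume p: "p = 1"
    have "y 0 \<noteq> y 1" using y_eq[of 0 1] p by simp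
    then have "(y 0, y 1) \<in> parcs H"
      using joined b_y(2) yV p by simp
    then have "{y 0, y 1} \<subseteq> nbhd H (y 0) \<inter> g (y 0)"
      using gy[of 0] yV[of 0] yV[of 1] in_g[of "y 0"] in_g[of "y 1"] p V by (auto simp: nbhd_def)
    moreover have "finite (nbhd H (y 0) \<inter> g (y 0))"
      using H.pair_finite_verts by (simp add: nbhd_def)
    ultimately have "2 \<le> card (nbhd H (y 0) \<inter> g (y 0))"
      using \<open>y 0 \<noteq> y 1\<close> card_mono[of "nbhd H (y 0) \<inter> g (y 0)" "{y 0, y 1}"] by simp
    moreover have "card (nbhd H (y 0) \<inter> g (y 0)) \<le> 1"
      using RG yV[of 0] p imageI[of "y 0" "pverts G" g] unfolding g_img by (simp add: R_graph_def)
    ultimately show False by simp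
  qed
  then have p: "p > 1" using y(1) by simp

  have "\<exists>\<pi>. vpath \<pi> (with_proj G) \<and> hd \<pi> = y (2 * q) \<and> last \<pi> = y (2 * q + 1)" if "q < p" for q
  proof -
    have "y (2 * q + 1) \<in> g (y (2 * q))"
      using gy[OF that] in_g[of "y (2 * q + 1)"] yV that by simp
    then show ?thesis
      unfolding G.reachable_vpath_conv[symmetric] by (simp add: g_def G.scc_of_def)
  qed
  then obtain \<pi> where \<pi>: "vpath (\<pi> q) (with_proj G)" "hd (\<pi> q) = y (2 * q)"
      "last (\<pi> q) = y (2 * q + 1)" if "q < p" for q
    by metis
  let ?ps = "map \<pi> [0..<p]"
  have "R_cycle G H ?ps"
    unfolding R_cycle_def
  proof (intro conjI allI impI)
    \<comment> \<open>Origins have even and termini odd indices in \<open>y\<close>, so parity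
      separates the two lists.\<close>
    show "distinct (map hd ?ps @ map last ?ps)"
      using \<pi> y_eq by (auto simp: distinct_map inj_on_def) presburger
    show "(last (?ps ! q), hd (?ps ! Suc q)) \<in> parcs H" if "Suc q < length ?ps" for q
      using joined[of "y (2 * q + 1)" "y (2 * Suc q)"] b_y(1)[of q] yV y_eq \<pi> that by simp
    have "last ?ps = \<pi> (p - 1)" "hd ?ps = \<pi> 0"
      using p by (auto simp: last_map hd_map)
    moreover have "2 * (p - 1) + 1 = 2 * p - 1" using p by linarith
    ultimately show "(last (last ?ps), hd (hd ?ps)) \<in> parcs H"
      using joined[of "y (2 * p - 1)" "y 0"] b_y(2) yV y_eq p \<pi>[of 0] \<pi>[of "p - 1"] by simp
  qed (use p \<pi> in auto)
  then show ?thesis ..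
qed

end
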